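(* Let $A$ and $B$ be good Fréchet algebras and let $\phi:A\to B$ be a dense and relatively spectral morphism. Then $\mathrm{csr}_k(A)=\mathrm{csr}_k(B)$ for all $k\ge 0$.
   Context: Algebras are complex and unital; morphisms are continuous unital algebra homomorphisms; subalgebras contain the unit. A Fréchet algebra is an algebra equipped with a countable family of submultiplicative seminorms (not required to be unital) making it a Fréchet space. A topological algebra is good if its group of invertibles $A^\times$ is open and inversion is continuous on $A^\times$. $\mathrm{sp}_A(a)$ denotes the spectrum of $a$ in $A$. A morphism $\phi:A\to B$ is dense if $\phi(A)$ is dense in $B$. It is relatively spectral if there is a dense subalgebra $X$ of $A$ with $\mathrm{sp}_B(\phi(x))=\mathrm{sp}_A(x)$ for all $x\in X$. For $n\ge 1$ put $\mathrm{Lg}_n(A)=\{(a_1,\dots,a_n)\in A^n: Aa_1+\dots+Aa_n=A\}$. For $k\ge 0$, the $k$-connected stable rank $\mathrm{csr}_k(A)$ is the least $n\geq 1$ such that $\mathrm{Lg}_m(A)$ is $k$-connected for all $m\ge n$ (and $\infty$ if there is no such $n$). A space $\Sigma$ is $k$-connected if $\pi_i(\Sigma,\bullet)=0$ for all $0\le i\le k$. *)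

theory Defs
  imports "HOL-Homology.Homology" "HOL-Library.Extended_Nat"
begin

text \<open>The base classes \<^class>\<open>ring\<close> and \<^class>\<open>monoid_mult\<close> are used instead of
  \<^class>\<open>ring_1\<close>, since the latter excludes the zero algebra.\<close>

class complex_unital_algebra = ring + monoid_mult +
  fixes scaleC :: "complex \<Rightarrow> 'a \<Rightarrow> 'a"
  assumes scaleC_add_right: "scaleC c (x + y) = scaleC c x + scaleC c y"
    and scaleC_add_left: "scaleC (c + d) x = scaleC c x + scaleC d x"
    and scaleC_scaleC: "scaleC c (scaleC d x) = scaleC (c * d) x"
    and scaleC_one: "scaleC 1 x = x"
    and mult_scaleC_left: "scaleC c x * y = scaleC c (x * y)"
    and mult_scaleC_right: "x * scaleC c y = scaleC c (x * y)"

definition invertibles :: "'a::complex_unital_algebra set" where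
  "invertibles = {a. \<exists>b. a * b = 1 \<and> b * a = 1}"

text \<open>Unspecified outside \<open>invertibles\<close>.\<close>

definition alg_inverse :: "'a::complex_unital_algebra \<Rightarrow> 'a" where
  "alg_inverse a = (THE b. a * b = 1 \<and> b * a = 1)"

definition alg_spectrum :: "'a::complex_unital_algebra \<Rightarrow> complex set" where
  "alg_spectrum a = {z. scaleC z 1 - a \<notin> invertibles}"

definition unital_subalgebra :: "'a::complex_unital_algebra set \<Rightarrow> bool" where
  "unital_subalgebra X \<longleftrightarrow>
     1 \<in> X \<and> (\<forall>x\<in>X. \<forall>y\<in>X. x + y \<in> X) \<and> (\<forall>x\<in>X. \<forall>y\<in>X. x * y \<in> X) \<and>
     (\<forall>c. \<forall>x\<in>X. scaleC c x \<in> X)"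

definition unital_algebra_hom ::
  "('a::complex_unital_algebra \<Rightarrow> 'b::complex_unital_algebra) \<Rightarrow> bool" where
  "unital_algebra_hom f \<longleftrightarrow>
     (\<forall>x y. f (x + y) = f x + f y) \<and> (\<forall>c x. f (scaleC c x) = scaleC c (f x)) \<and>
     (\<forall>x y. f (x * y) = f x * f y) \<and> f 1 = 1"

text \<open>The family of seminorms is indexed by the natural numbers; a finite family is covered by
  repeating its members. The topology is Hausdorff by \<open>seminorms_separating\<close>, and since it
  is then metrizable by a translation-invariant metric, completeness can be expressed by Cauchy
  sequences. Non-negativity of the seminorms follows from the other axioms.\<close>

class frechet_algebra = complex_unital_algebra + topological_space +
  fixes seminorms :: "nat \<Rightarrow> 'a \<Rightarrow> real"
  assumes seminorms_triangle: "seminorms i (x + y) \<le> seminorms i x + seminorms i y"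
    and seminorms_scaleC: "seminorms i (scaleC c x) = cmod c * seminorms i x"
    and seminorms_mult: "seminorms i (x * y) \<le> seminorms i x * seminorms i y"
    and open_seminorms:
      "open U \<longleftrightarrow> (\<forall>x\<in>U. \<exists>N. \<exists>e>0. \<forall>y. (\<forall>i<N. seminorms i (y - x) < e) \<longrightarrow> y \<in> U)"
    and seminorms_separating: "(\<And>i. seminorms i x = 0) \<Longrightarrow> x = 0"
    and seminorms_complete:
      "(\<And>i e. e > 0 \<Longrightarrow> \<exists>M. \<forall>m\<ge>M. \<forall>n\<ge>M. seminorms i (s m - s n) < e)
       \<Longrightarrow> \<exists>l. \<forall>i. (\<lambda>n. seminorms i (s n - l)) \<longlonglongrightarrow> 0"

definition good_algebra :: "'a::{complex_unital_algebra, topological_space} itself \<Rightarrow> bool" where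
  "good_algebra _ \<longleftrightarrow>
     open (invertibles :: 'a set) \<and> continuous_on (invertibles :: 'a set) alg_inverse"

definition algebra_morphism ::
  "('a::{complex_unital_algebra, topological_space} \<Rightarrow>
    'b::{complex_unital_algebra, topological_space}) \<Rightarrow> bool" where
  "algebra_morphism f \<longleftrightarrow> unital_algebra_hom f \<and> continuous_on UNIV f"

definition dense_morphism :: "('a \<Rightarrow> 'b::topological_space) \<Rightarrow> bool" where
  "dense_morphism f \<longleftrightarrow> closure (range f) = UNIV"

definition relatively_spectral ::
  "('a::{complex_unital_algebra, topological_space} \<Rightarrow> 'b::complex_unital_algebra) \<Rightarrow> bool" where
  "relatively_spectral f \<longleftrightarrow>
     (\<exists>X. unital_subalgebra X \<and> closure X = UNIV \<and>
          (\<forall>x\<in>X. alg_spectrum (f x) = alg_spectrum x))"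

text \<open>The underlying set of \<open>\<pi>\<^sub>n(T, x)\<close>: pointed homotopy classes of pointed maps from the
  \<open>n\<close>-sphere to \<open>T\<close>. The group structure (for positive \<open>n\<close>) is irrelevant to the
  vanishing of \<open>\<pi>\<^sub>n(T, x)\<close>, which means that there is exactly one class. As the 0-sphere has
  exactly two points, the case \<open>n = 0\<close> gives the set of path components. Maps are not
  normalised outside the sphere, but maps that agree on the sphere are in the same class.\<close>

definition sphere_base :: "nat \<Rightarrow> real" where
  "sphere_base = (\<lambda>j. if j = 0 then 1 else 0)"

definition pointed_sphere_maps :: "nat \<Rightarrow> 'a topology \<Rightarrow> 'a \<Rightarrow> ((nat \<Rightarrow> real) \<Rightarrow> 'a) set" where
  "pointed_sphere_maps n T x = {f. continuous_map (nsphere n) T f \<and> f sphere_base = x}"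

definition homotopy_classes :: "nat \<Rightarrow> 'a topology \<Rightarrow> 'a \<Rightarrow> ((nat \<Rightarrow> real) \<Rightarrow> 'a) set set" where
  "homotopy_classes n T x =
     pointed_sphere_maps n T x //
       {(f, g). homotopic_with (\<lambda>h. h sphere_base = x) (nsphere n) T f g}"

definition k_connected_space :: "nat \<Rightarrow> 'a topology \<Rightarrow> bool" where
  "k_connected_space k T \<longleftrightarrow>
     topspace T \<noteq> {} \<and> (\<forall>i\<le>k. \<forall>x\<in>topspace T. is_singleton (homotopy_classes i T x))"

text \<open>An \<open>n\<close>-tuple is a function on \<open>{..<n}\<close>, extended by \<open>undefined\<close> as in
  \<^const>\<open>product_topology\<close>. The sum of the left ideals generated by the entries
  is written as the range of the map sending coefficients \<open>c\<close> to \<open>\<Sum>i<n. c i * a i\<close>.\<close>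

definition Lg :: "nat \<Rightarrow> (nat \<Rightarrow> 'a::complex_unital_algebra) set" where
  "Lg n = {a \<in> {..<n} \<rightarrow>\<^sub>E UNIV. range (\<lambda>c :: nat \<Rightarrow> 'a. \<Sum>i<n. c i * a i) = UNIV}"

definition Lg_space ::
  "nat \<Rightarrow> (nat \<Rightarrow> 'a::{complex_unital_algebra, topological_space}) topology" where
  "Lg_space n = subtopology (product_topology (\<lambda>_. euclidean) {..<n}) (Lg n)"

definition csr :: "nat \<Rightarrow> 'a::{complex_unital_algebra, topological_space} itself \<Rightarrow> enat" where
  "csr k _ =
     (let R = {n. n \<ge> 1 \<and> (\<forall>m\<ge>n. k_connected_space k (Lg_space m :: (nat \<Rightarrow> 'a) topology))}
      in if R = {} then \<infinity> else enat (LEAST n. n \<in> R))"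

end

theory Submission
  imports Defs
begin

text \<open>Openness of the invertibles makes unimodularity an open condition, and relative spectrality
  gives, for a tuple \<open>x\<close> over the dense subalgebra \<open>X\<close>, that \<open>x\<close> is unimodular as soon as
  its image is. By local convexity a map from a compact space into unimodular tuples over \<open>B\<close> can be
  approximated by the image of an \<open>X\<close>-valued map, with the connecting segments staying
  unimodular; the \<open>X\<close>-valued map is then itself unimodular. Applied to spheres this transports
  null-homotopies from \<open>A\<close> to \<open>B\<close>; applied to a homotopy over \<open>B\<close> between images of
  \<open>X\<close>-valued maps, it lifts the homotopy to \<open>A\<close> up to segments at both ends. The
  approximation moves base points, so vanishing of all homotopy sets is first expressed through
  free null-homotopies.\<close>

section \<open>Frechet algebras\<close>

lemma scaleC_zero_left [simp]: "scaleC 0 (x::'a::complex_unital_algebra) = 0"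
  using scaleC_add_left[of 0 0 x] by simp

lemma scaleC_zero_right [simp]: "scaleC c (0::'a::complex_unital_algebra) = 0"
  using scaleC_add_right[of c 0 "0::'a"] by simp

lemma scaleC_minus_left: "scaleC (- c) (x::'a::complex_unital_algebra) = - scaleC c x"
  using scaleC_add_left[of c "-c" x] by (simp add: eq_neg_iff_add_eq_0 add.commute)

lemma scaleC_minus_right: "scaleC c (- x::'a::complex_unital_algebra) = - scaleC c x"
  using scaleC_add_right[of c x "-x"] by (simp add: eq_neg_iff_add_eq_0 add.commute)

lemma scaleC_diff_left: "scaleC (c - d) (x::'a::complex_unital_algebra) = scaleC c x - scaleC d x"
  using scaleC_add_left[of c "-d" x] by (simp add: scaleC_minus_left)

lemma scaleC_diff_right: "scaleC c (x - y::'a::complex_unital_algebra) = scaleC c x - scaleC c y"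
  using scaleC_add_right[of c x "-y"] by (simp add: scaleC_minus_right)

lemma scaleC_sum_left:
  "scaleC (\<Sum>i\<in>S. c i) (x::'a::complex_unital_algebra) = (\<Sum>i\<in>S. scaleC (c i) x)"
  by (induction S rule: infinite_finite_induct) (simp_all add: scaleC_add_left)

lemma seminorms_zero [simp]: "seminorms i (0::'a::frechet_algebra) = 0"
  using seminorms_scaleC[of i 0 "0::'a"] by simp

lemma seminorms_minus [simp]: "seminorms i (- x) = seminorms i (x::'a::frechet_algebra)"
  using seminorms_scaleC[of i "-1" x] by (simp add: scaleC_minus_left scaleC_one)

lemma seminorms_minus_commute: "seminorms i (x - y) = seminorms i (y - x::'a::frechet_algebra)"
  using seminorms_minus[of i "x - y"] by simp

lemma seminorms_nonneg [simp]: "0 \<le> seminorms i (x::'a::frechet_algebra)"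
  using seminorms_triangle[of i x "-x"] by simp

lemma seminorms_sum:
  "seminorms i (\<Sum>l\<in>S. f l) \<le> (\<Sum>l\<in>S. seminorms i (f l :: 'a::frechet_algebra))"
proof (induction S rule: infinite_finite_induct)
  case (insert l S)
  then show ?case
    using seminorms_triangle[of i "f l" "\<Sum>l\<in>S. f l"] by simp
qed simp_all

text \<open>Continuity of the operations thereby reduces to limits of real functions. Forward, the
  sets \<open>{y. seminorms i (y - l) < e}\<close> are open; backward, a basic neighbourhood
  involves finitely many seminorms, so finitely many eventual bounds can be combined.\<close>

lemma tendsto_iff_seminorms:
  fixes f :: "'k \<Rightarrow> 'a::frechet_algebra"
  shows "(f \<longlongrightarrow> l) F \<longleftrightarrow> (\<forall>i. ((\<lambda>x. seminorms i (f x - l)) \<longlongrightarrow> 0) F)"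
proof
  assume lim: "(f \<longlongrightarrow> l) F"
  show "\<forall>i. ((\<lambda>x. seminorms i (f x - l)) \<longlongrightarrow> 0) F"
  proof (intro allI tendstoI)
    fix i and e :: real assume "e > 0"
    have "open {y. seminorms i (y - l) < e}"
      unfolding open_seminorms
    proof
      fix x assume x: "x \<in> {y. seminorms i (y - l) < e}"
      have "seminorms i (y - l) < e" if "seminorms i (y - x) < e - seminorms i (x - l)" for y
        using seminorms_triangle[of i "y - x" "x - l"] that by simp
      \<comment> \<open>Neighbourhoods control the indices below \<open>N\<close>, hence
        \<open>Suc i\<close> to include \<open>i\<close>; the radius is what the triangle inequality
        leaves.\<close>
      with x show "\<exists>N. \<exists>d>0. \<forall>y. (\<forall>i<N. seminorms i (y - x) < d) \<longrightarrow> y \<in> {y. seminorms i (y - l) < e}"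
        by (intro exI[of _ "Suc i"] exI[of _ "e - seminorms i (x - l)"]) auto
    qed
    then have "\<forall>\<^sub>F x in F. f x \<in> {y. seminorms i (y - l) < e}"
      using lim \<open>e > 0\<close> by (intro topological_tendstoD) auto
    then show "\<forall>\<^sub>F x in F. dist (seminorms i (f x - l)) 0 < e"
      by eventually_elim simp
  qed
next
  assume lim: "\<forall>i. ((\<lambda>x. seminorms i (f x - l)) \<longlongrightarrow> 0) F"
  show "(f \<longlongrightarrow> l) F"
  proof (rule topological_tendstoI)
    fix S :: "'a set" assume "open S" "l \<in> S"
    then obtain N e where "e > 0" and S: "\<And>y. (\<forall>i<N. seminorms i (y - l) < e) \<Longrightarrow> y \<in> S"
      unfolding open_seminorms by metis
    have "\<forall>\<^sub>F x in F. \<forall>i\<in>{..<N}. seminorms i (f x - l) < e"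
      using lim \<open>e > 0\<close> by (intro eventually_ball_finite ballI order_tendstoD) auto
    then show "\<forall>\<^sub>F x in F. f x \<in> S"
      by eventually_elim (use S in auto)
  qed
qed

section \<open>Continuity of the algebra operations\<close>

lemma tendsto_squeeze_zero:
  fixes f g :: "'k \<Rightarrow> real"
  assumes "(g \<longlongrightarrow> 0) F" "\<And>x. 0 \<le> f x" "\<And>x. f x \<le> g x"
  shows "(f \<longlongrightarrow> 0) F"
  by (rule tendsto_sandwich[OF _ _ tendsto_const assms(1)]) (use assms in auto)

lemma tendsto_add_frechet:
  fixes f g :: "'k \<Rightarrow> 'a::frechet_algebra"
  assumes "(f \<longlongrightarrow> a) F" "(g \<longlongrightarrow> b) F"
  shows "((\<lambda>x. f x + g x) \<longlongrightarrow> a + b) F"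
  unfolding tendsto_iff_seminorms
proof
  fix i
  have "((\<lambda>x. seminorms i (f x - a) + seminorms i (g x - b)) \<longlongrightarrow> 0 + 0) F"
    using assms unfolding tendsto_iff_seminorms by (intro tendsto_add) auto
  moreover have "seminorms i (f x + g x - (a + b)) \<le> seminorms i (f x - a) + seminorms i (g x - b)" for x
    using seminorms_triangle[of i "f x - a" "g x - b"] by (simp add: add_diff_add)
  ultimately show "((\<lambda>x. seminorms i (f x + g x - (a + b))) \<longlongrightarrow> 0) F"
    by - (rule tendsto_squeeze_zero[where g = "\<lambda>x. seminorms i (f x - a) + seminorms i (g x - b)"], simp_all)
qed

lemma tendsto_seminorms:
  fixes f :: "'k \<Rightarrow> 'a::frechet_algebra"
  assumes "(f \<longlongrightarrow> a) F"
  shows "((\<lambda>x. seminorms i (f x)) \<longlongrightarrow> seminorms i a) F"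
proof -
  have "\<bar>seminorms i (f x) - seminorms i a\<bar> \<le> seminorms i (f x - a)" for x
    using seminorms_triangle[of i "f x - a" a] seminorms_triangle[of i "a - f x" "f x"]
      seminorms_minus_commute[of i a "f x"] by simp
  then have "((\<lambda>x. \<bar>seminorms i (f x) - seminorms i a\<bar>) \<longlongrightarrow> 0) F"
    using assms unfolding tendsto_iff_seminorms
    by - (rule tendsto_squeeze_zero[where g = "\<lambda>x. seminorms i (f x - a)"], auto)
  then show ?thesis
    by (simp add: tendsto_rabs_zero_iff LIM_zero_iff)
qed

lemma tendsto_scaleC:
  fixes f :: "'k \<Rightarrow> 'a::frechet_algebra"
  assumes "(c \<longlongrightarrow> d) F" "(f \<longlongrightarrow> a) F"
  shows "((\<lambda>x. scaleC (c x) (f x)) \<longlongrightarrow> scaleC d a) F"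
  unfolding tendsto_iff_seminorms
proof
  fix i
  let ?g = "\<lambda>x. cmod (c x - d) * seminorms i (f x) + cmod d * seminorms i (f x - a)"
  have "((\<lambda>x. cmod (c x - d)) \<longlongrightarrow> 0) F"
    using assms(1) by (simp add: LIM_zero tendsto_norm_zero)
  then have "(?g \<longlongrightarrow> 0 * seminorms i a + cmod d * 0) F"
    using assms(2) tendsto_seminorms[OF assms(2)]
    by (intro tendsto_add tendsto_mult tendsto_const) (auto simp: tendsto_iff_seminorms)
  moreover have "seminorms i (scaleC (c x) (f x) - scaleC d a) \<le> ?g x" for x
  proof -
    have "scaleC (c x) (f x) - scaleC d a = scaleC (c x - d) (f x) + scaleC d (f x - a)"
      by (simp add: scaleC_diff_left scaleC_diff_right)
    then show ?thesis
      using seminorms_triangle[of i "scaleC (c x - d) (f x)" "scaleC d (f x - a)"]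
      by (simp add: seminorms_scaleC)
  qed
  ultimately show "((\<lambda>x. seminorms i (scaleC (c x) (f x) - scaleC d a)) \<longlongrightarrow> 0) F"
    by - (rule tendsto_squeeze_zero[where g = ?g], auto)
qed

text \<open>One factor is held fixed: in \<open>openin_Lg\<close> the coefficients are fixed and the
  tuple varies; in \<open>Lg_reflect\<close>, which uses the right-hand version, it is the other way
  round.\<close>

lemma tendsto_mult_left_frechet:
  fixes f :: "'k \<Rightarrow> 'a::frechet_algebra"
  assumes "(f \<longlongrightarrow> a) F"
  shows "((\<lambda>x. c * f x) \<longlongrightarrow> c * a) F"
  unfolding tendsto_iff_seminorms
proof
  fix i
  have "((\<lambda>x. seminorms i c * seminorms i (f x - a)) \<longlongrightarrow> seminorms i c * 0) F"
    using assms unfolding tendsto_iff_seminorms by (intro tendsto_mult) auto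
  moreover have "seminorms i (c * f x - c * a) \<le> seminorms i c * seminorms i (f x - a)" for x
    using seminorms_mult[of i c "f x - a"] by (simp add: right_diff_distrib)
  ultimately show "((\<lambda>x. seminorms i (c * f x - c * a)) \<longlongrightarrow> 0) F"
    by - (rule tendsto_squeeze_zero[where g = "\<lambda>x. seminorms i c * seminorms i (f x - a)"], simp_all)
qed

lemma tendsto_mult_right_frechet:
  fixes f :: "'k \<Rightarrow> 'a::frechet_algebra"
  assumes "(f \<longlongrightarrow> a) F"
  shows "((\<lambda>x. f x * c) \<longlongrightarrow> a * c) F"
  unfolding tendsto_iff_seminorms
proof
  fix i
  have "((\<lambda>x. seminorms i (f x - a) * seminorms i c) \<longlongrightarrow> 0 * seminorms i c) F"
    using assms unfolding tendsto_iff_seminorms by (intro tendsto_mult) auto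
  moreover have "seminorms i (f x * c - a * c) \<le> seminorms i (f x - a) * seminorms i c" for x
    using seminorms_mult[of i "f x - a" c] by (simp add: left_diff_distrib)
  ultimately show "((\<lambda>x. seminorms i (f x * c - a * c)) \<longlongrightarrow> 0) F"
    by - (rule tendsto_squeeze_zero[where g = "\<lambda>x. seminorms i (f x - a) * seminorms i c"], simp_all)
qed

lemma tendsto_sum_frechet:
  fixes f :: "'s \<Rightarrow> 'k \<Rightarrow> 'a::frechet_algebra"
  assumes "\<And>l. l \<in> S \<Longrightarrow> (f l \<longlongrightarrow> a l) F"
  shows "((\<lambda>x. \<Sum>l\<in>S. f l x) \<longlongrightarrow> (\<Sum>l\<in>S. a l)) F"
  using assms
  by (induction S rule: infinite_finite_induct) (auto intro: tendsto_add_frechet)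

lemma continuous_map_euclidean_tendsto:
  "continuous_map K euclidean f \<longleftrightarrow> (\<forall>x\<in>topspace K. (f \<longlongrightarrow> f x) (atin K x))"
  by (simp add: continuous_map_atin)

section \<open>Homotopy sets and free null-homotopies\<close>

text \<open>The sphere sits in an infinite power of the reals as a closed subset of the cube with
  sides \<open>{-1..1}\<close>, which is compact by Tychonoff.\<close>

lemma compact_space_nsphere: "compact_space (nsphere n)"
proof -
  let ?P = "powertop_real (UNIV :: nat set)"
  let ?B = "PiE UNIV (\<lambda>_. {-1..1}) :: (nat \<Rightarrow> real) set"
  let ?S = "{x. (\<Sum>i\<le>n. x i ^ 2) = 1 \<and> (\<forall>i>n. x i = 0)} :: (nat \<Rightarrow> real) set"
  have closed: "closedin ?P ?S"
  proof -
    have "closedin ?P {x \<in> topspace ?P. (\<Sum>i\<le>n. x i ^ 2) \<in> {1}}"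
      by (intro closedin_continuous_map_preimage[where Y = euclideanreal] continuous_intros) auto
    moreover have "closedin ?P {x \<in> topspace ?P. x i \<in> {0}}" for i
      by (intro closedin_continuous_map_preimage[where Y = euclideanreal] continuous_intros) auto
    then have "closedin ?P (\<Inter>i\<in>{n<..}. {x \<in> topspace ?P. x i \<in> {0}})"
      by (intro closedin_Inter) auto
    moreover have "?S = {x \<in> topspace ?P. (\<Sum>i\<le>n. x i ^ 2) \<in> {1}} \<inter>
        (\<Inter>i\<in>{n<..}. {x \<in> topspace ?P. x i \<in> {0}})"
      by auto
    ultimately show ?thesis
      by (metis (no_types, lifting) closedin_Int)
  qed
  have "?S \<subseteq> ?B"
  proof
    fix x assume x: "x \<in> ?S"
    have "x i \<in> {-1..1}" for i
    proof (cases "i \<le> n")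
      case True
      then have "x i ^ 2 \<le> (\<Sum>i\<le>n. x i ^ 2)"
        by (intro member_le_sum) auto
      then show ?thesis
        using x by (simp add: abs_square_le_1 abs_le_iff)
    qed (use x in auto)
    then show "x \<in> ?B" by auto
  qed
  moreover have "compactin ?P ?B"
    unfolding compactin_PiE by simp
  ultimately have "compactin ?P ?S"
    using closed by - (rule closed_compactin[where K = ?B])
  then show ?thesis
    unfolding nsphere by (rule compact_space_subtopology)
qed

lemma sphere_base_in_nsphere: "sphere_base \<in> topspace (nsphere n)"
  unfolding sphere_base_def by (rule in_topspace_nsphere)

text \<open>Points of the disk are kept as sequences vanishing beyond \<open>n\<close>, like those
  of \<open>nsphere n\<close>; on them this is the Euclidean norm.\<close>

definition enorm :: "nat \<Rightarrow> (nat \<Rightarrow> real) \<Rightarrow> real" where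
  "enorm n y = sqrt (\<Sum>i\<le>n. y i ^ 2)"

lemma enorm_nsphere: "y \<in> topspace (nsphere n) \<Longrightarrow> enorm n y = 1"
  by (simp add: enorm_def nsphere)

lemma normalize_in_nsphere:
  assumes "enorm n y \<noteq> 0" "\<And>i. i > n \<Longrightarrow> y i = 0"
  shows "(\<lambda>i. y i / enorm n y) \<in> topspace (nsphere n)"
proof -
  have "(\<Sum>i\<le>n. (y i / enorm n y)\<^sup>2) = (\<Sum>i\<le>n. y i ^ 2) / (enorm n y)\<^sup>2"
    by (simp add: power_divide sum_divide_distrib)
  also have "(enorm n y)\<^sup>2 = (\<Sum>i\<le>n. y i ^ 2)"
    by (simp add: enorm_def sum_nonneg)
  finally show ?thesis
    using assms by (auto simp: nsphere enorm_def)
qed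

text \<open>The free null-homotopy is read as a map on the disk that is constant near the centre, so
  that no quotient topology is needed; the disk is then contracted to the base point.\<close>

lemma nullhomotopic_imp_pointed_nullhomotopic:
  assumes "homotopic_with (\<lambda>_. True) (nsphere n) T f (\<lambda>_. c)"
  shows "homotopic_with (\<lambda>h. h sphere_base = f sphere_base) (nsphere n) T f (\<lambda>_. f sphere_base)"
proof -
  let ?K = "prod_topology (top_of_set {0..1::real}) (nsphere n)"
  obtain H where H: "continuous_map ?K T H" "\<And>x. H (0, x) = f x" "\<And>x. H (1, x) = c"
    using assms unfolding homotopic_with_def by blast
  \<comment> \<open>The straight path in the disk from \<open>x\<close> to the base point; it stays
    put when \<open>x\<close> is the base point.\<close>
  define y where "y = (\<lambda>(t::real, x) i. (1 - t) * x i + t * sphere_base i)"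
  \<comment> \<open>On a point of the disk of radius \<open>r\<close>, the direction is the sphere
    argument of \<open>H\<close> and \<open>2 * (1 - r)\<close> its time: radius 1 gives time 0,
    radius 1/2 gives time 1. Clamping puts the time into the unit interval without a bound on
    \<open>r\<close>, and the cut at 1/2 avoids division by zero.\<close>
  define G where "G = (\<lambda>z. if enorm n (y z) \<le> 1/2 then c
    else H (max 0 (min 1 (2 * (1 - enorm n (y z)))), \<lambda>i. y z i / enorm n (y z)))"
  have proj: "continuous_map ?K euclideanreal (\<lambda>z. snd z i)" for i
    using continuous_map_compose[OF continuous_map_snd continuous_map_nsphere_projection]
    by (simp add: o_def)
  have time: "continuous_map ?K euclideanreal fst"
    using continuous_map_fst continuous_map_into_fulltopology by blast
  have y: "continuous_map ?K euclideanreal (\<lambda>z. y z i)" for i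
    unfolding y_def case_prod_unfold by (intro continuous_intros proj time)
  have norm_y: "continuous_map ?K euclideanreal (\<lambda>z. enorm n (y z))"
    unfolding enorm_def by (intro continuous_intros y) auto
  have y_zero: "y z i = 0" if "z \<in> topspace ?K" "i > n" for z i
    using that by (auto simp: y_def sphere_base_def nsphere)
  have G: "continuous_map ?K T G"
    unfolding G_def
  proof (rule continuous_map_cases_le[OF norm_y])
    show "continuous_map ?K euclideanreal (\<lambda>z. 1/2)" by simp
    have "c \<in> topspace T"
      using assms homotopic_with_imp_continuous_maps sphere_base_in_nsphere[of n]
      by (metis continuous_map_def funcset_mem)
    then show "continuous_map (subtopology ?K {z \<in> topspace ?K. enorm n (y z) \<le> 1/2}) T (\<lambda>z. c)"
      by simp
    let ?L = "subtopology ?K {z \<in> topspace ?K. 1/2 \<le> enorm n (y z)}"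
    have nz: "enorm n (y z) \<noteq> 0" if "z \<in> topspace ?L" for z
      using that by (auto simp del: topspace_prod_topology)
    have "continuous_map ?L (subtopology (powertop_real UNIV)
        {x. (\<Sum>i\<le>n. (x i)\<^sup>2) = 1 \<and> (\<forall>i>n. x i = 0)}) (\<lambda>z i. y z i / enorm n (y z))"
      unfolding continuous_map_in_subtopology
    proof
      show "continuous_map ?L (powertop_real UNIV) (\<lambda>z i. y z i / enorm n (y z))"
        unfolding continuous_map_componentwise_UNIV
        by (intro allI continuous_map_real_divide continuous_map_from_subtopology y norm_y nz)
      have "(\<lambda>i. y z i / enorm n (y z)) \<in> topspace (nsphere n)" if "z \<in> topspace ?L" for z
        using that by (intro normalize_in_nsphere nz y_zero) auto
      then show "(\<lambda>z i. y z i / enorm n (y z)) \<in> topspace ?L \<rightarrow>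
          {x. (\<Sum>i\<le>n. (x i)\<^sup>2) = 1 \<and> (\<forall>i>n. x i = 0)}"
        by (auto simp: nsphere)
    qed
    then have "continuous_map ?L (nsphere n) (\<lambda>z i. y z i / enorm n (y z))"
      by (simp only: nsphere[symmetric])
    moreover have "continuous_map ?L (top_of_set {0..1}) (\<lambda>z. max 0 (min 1 (2 * (1 - enorm n (y z)))))"
      unfolding continuous_map_in_subtopology
      by (auto intro!: continuous_intros continuous_map_from_subtopology norm_y)
    ultimately have "continuous_map ?L ?K
        (\<lambda>z. (max 0 (min 1 (2 * (1 - enorm n (y z)))), \<lambda>i. y z i / enorm n (y z)))"
      by (simp add: continuous_map_pairwise o_def)
    from continuous_map_compose[OF this H(1)]
    show "continuous_map ?L T
        (\<lambda>z. H (max 0 (min 1 (2 * (1 - enorm n (y z)))), \<lambda>i. y z i / enorm n (y z)))"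
      by (simp add: o_def)
    \<comment> \<open>The two pieces agree on the overlap because the time is 1 there.\<close>
    show "c = H (max 0 (min 1 (2 * (1 - enorm n (y z)))), \<lambda>i. y z i / enorm n (y z))"
      if "enorm n (y z) = 1/2" for z
      using that H(3) by simp
  qed
  \<comment> \<open>All three conditions on the homotopy come from this: \<open>y z\<close> is on
    the sphere at time 0, at time 1, and along the base point.\<close>
  have on_sphere: "G z = f (y z)" if "y z \<in> topspace (nsphere n)" for z
    using that by (simp add: G_def H enorm_nsphere)
  show ?thesis
  \<comment> \<open>The side condition discharged here is that pointedness depends only on the
    values on the sphere, which holds as \<open>sphere_base\<close> lies on it.\<close>
  proof (subst homotopic_with, (use sphere_base_in_nsphere in auto)[1], intro exI conjI ballI)
    show "continuous_map ?K T G" by (rule G)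
    show "G (0, x) = f x" if "x \<in> topspace (nsphere n)" for x
      using that on_sphere[of "(0, x)"] by (simp add: y_def)
    have "y (1, x) = sphere_base" for x
      by (simp add: y_def)
    then show "G (1, x) = f sphere_base" for x
      using on_sphere[of "(1, x)"] by (simp add: sphere_base_in_nsphere)
    have "y (t, sphere_base) = sphere_base" for t
      by (auto simp: y_def algebra_simps)
    then show "G (t, sphere_base) = f sphere_base" for t
      using on_sphere[of "(t, sphere_base)"] by (simp add: sphere_base_in_nsphere)
  qed
qed

text \<open>Since all base points are allowed, each map can be taken as pointed at its own value at
  \<open>sphere_base\<close>. The right-hand side is free of base points; the way back is
  \<open>nullhomotopic_imp_pointed_nullhomotopic\<close>.\<close>

lemma trivial_homotopy_classes_iff:
  "(\<forall>x\<in>topspace T. is_singleton (homotopy_classes n T x)) \<longleftrightarrow>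
   (\<forall>f. continuous_map (nsphere n) T f \<longrightarrow>
      (\<exists>c. homotopic_with (\<lambda>_. True) (nsphere n) T f (\<lambda>_. c)))"
proof (intro iffI allI impI ballI)
  fix f assume sing: "\<forall>x\<in>topspace T. is_singleton (homotopy_classes n T x)"
    and f: "continuous_map (nsphere n) T f"
  define x where "x = f sphere_base"
  define r where "r = {(f, g). homotopic_with (\<lambda>h. h sphere_base = x) (nsphere n) T f g}"
  have x: "x \<in> topspace T"
    using continuous_map_image_subset_topspace[OF f] sphere_base_in_nsphere[of n] by (auto simp: x_def)
  have mem: "f \<in> pointed_sphere_maps n T x" "(\<lambda>_. x) \<in> pointed_sphere_maps n T x"
    using f x by (auto simp: pointed_sphere_maps_def x_def)
  obtain C where "pointed_sphere_maps n T x // r = {C}"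
    using sing x unfolding is_singleton_def homotopy_classes_def r_def by blast
  \<comment> \<open>Members of a singleton quotient coincide; reflexivity at the constant map then
    places it in the class of \<open>f\<close>.\<close>
  then have "r `` {f} = r `` {\<lambda>_. x}"
    using quotientI[OF mem(1), of r] quotientI[OF mem(2), of r] by simp
  moreover have "(\<lambda>_. x) \<in> r `` {\<lambda>_. x}"
    using x by (simp add: r_def)
  ultimately have "(\<lambda>_. x) \<in> r `` {f}"
    by simp
  then have "homotopic_with (\<lambda>h. h sphere_base = x) (nsphere n) T f (\<lambda>_. x)"
    by (simp add: r_def)
  then have "homotopic_with (\<lambda>_. True) (nsphere n) T f (\<lambda>_. x)"
    by (rule homotopic_with_mono) simp
  then show "\<exists>c. homotopic_with (\<lambda>_. True) (nsphere n) T f (\<lambda>_. c)"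
    by (rule exI)
next
  fix x assume null: "\<forall>f. continuous_map (nsphere n) T f \<longrightarrow>
      (\<exists>c. homotopic_with (\<lambda>_. True) (nsphere n) T f (\<lambda>_. c))" and x: "x \<in> topspace T"
  define r where "r = {(f, g). homotopic_with (\<lambda>h. h sphere_base = x) (nsphere n) T f g}"
  let ?c = "\<lambda>_ :: nat \<Rightarrow> real. x"
  have c: "?c \<in> pointed_sphere_maps n T x"
    using x by (simp add: pointed_sphere_maps_def)
  have "r `` {f} = r `` {?c}" if "f \<in> pointed_sphere_maps n T x" for f
  proof -
    have hom: "homotopic_with (\<lambda>h. h sphere_base = x) (nsphere n) T f ?c"
      using nullhomotopic_imp_pointed_nullhomotopic[of n T f] null that
      by (auto simp: pointed_sphere_maps_def)
    show ?thesis
    \<comment> \<open>The classes are compared elementwise through symmetry and transitivity of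
      homotopy, without first making \<open>r\<close> an equivalence relation on the pointed
      maps.\<close>
    proof (rule Set.set_eqI)
      fix g
      show "g \<in> r `` {f} \<longleftrightarrow> g \<in> r `` {?c}"
        using homotopic_with_trans[OF hom, of g]
          homotopic_with_trans[OF homotopic_with_symD[OF hom], of g]
        by (simp only: r_def Image_singleton_iff mem_Collect_eq case_prod_conv) argo
    qed
  qed
  then have classes: "(\<lambda>f. r `` {f}) ` pointed_sphere_maps n T x = (\<lambda>_. r `` {?c}) ` pointed_sphere_maps n T x"
    by (rule image_cong[OF refl])
  have "pointed_sphere_maps n T x // r = (\<lambda>f. r `` {f}) ` pointed_sphere_maps n T x"
    by (simp add: quotient_def UNION_singleton_eq_range)
  then have "pointed_sphere_maps n T x // r = {r `` {?c}}"
    using classes image_constant[OF c] by simp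
  then show "is_singleton (homotopy_classes n T x)"
    unfolding homotopy_classes_def r_def by (simp add: is_singleton_def)
qed

section \<open>Approximation of maps into tuples\<close>

lemma continuous_map_seminorms_diff:
  fixes g :: "'k \<Rightarrow> 'a::frechet_algebra"
  assumes "continuous_map K euclidean g"
  shows "continuous_map K euclideanreal (\<lambda>k. seminorms i (g k - b))"
  unfolding continuous_map_euclidean_tendsto
proof
  fix x assume "x \<in> topspace K"
  then have "(g \<longlongrightarrow> g x) (atin K x)"
    using assms by (simp add: continuous_map_euclidean_tendsto)
  from tendsto_seminorms[OF tendsto_add_frechet[OF this tendsto_const[of "- b"]]]
  show "((\<lambda>k. seminorms i (g k - b)) \<longlongrightarrow> seminorms i (g x - b)) (atin K x)"
    by simp
qed

lemma continuous_map_scaleC: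
  fixes g :: "'k \<Rightarrow> 'a::frechet_algebra"
  assumes "continuous_map K euclideanreal c" "continuous_map K euclidean g"
  shows "continuous_map K euclidean (\<lambda>k. scaleC (of_real (c k)) (g k))"
  using assms unfolding continuous_map_euclidean_tendsto
  by (intro ballI tendsto_scaleC tendsto_of_real) auto

lemma continuous_map_add_frechet:
  fixes f g :: "'k \<Rightarrow> 'a::frechet_algebra"
  assumes "continuous_map K euclidean f" "continuous_map K euclidean g"
  shows "continuous_map K euclidean (\<lambda>k. f k + g k)"
  using assms unfolding continuous_map_euclidean_tendsto
  by (intro ballI tendsto_add_frechet) auto

lemma continuous_map_sum_frechet:
  fixes f :: "'s \<Rightarrow> 'k \<Rightarrow> 'a::frechet_algebra"
  assumes "\<And>l. l \<in> S \<Longrightarrow> continuous_map K euclidean (f l)"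
  shows "continuous_map K euclidean (\<lambda>k. \<Sum>l\<in>S. f l k)"
  using assms unfolding continuous_map_euclidean_tendsto
  by (intro ballI tendsto_sum_frechet) auto

lemma continuous_map_mult_left_frechet:
  fixes f :: "'k \<Rightarrow> 'a::frechet_algebra"
  assumes "continuous_map K euclidean f"
  shows "continuous_map K euclidean (\<lambda>k. c * f k)"
  using assms unfolding continuous_map_euclidean_tendsto
  by (intro ballI tendsto_mult_left_frechet) auto

lemma continuous_map_mult_right_frechet:
  fixes f :: "'k \<Rightarrow> 'a::frechet_algebra"
  assumes "continuous_map K euclidean f"
  shows "continuous_map K euclidean (\<lambda>k. f k * c)"
  using assms unfolding continuous_map_euclidean_tendsto
  by (intro ballI tendsto_mult_right_frechet) auto

section \<open>Seminorm distances and neighbourhoods of tuples\<close>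

abbreviation tuples :: "nat \<Rightarrow> (nat \<Rightarrow> 'a::topological_space) topology" where
  "tuples m \<equiv> product_topology (\<lambda>_. euclidean) {..<m}"

text \<open>Sums in place of maxima let continuity and convexity follow termwise. \<open>N\<close>
  is chosen together with a radius, as a neighbourhood may involve any finite number of
  seminorms.\<close>

definition tdist :: "nat \<Rightarrow> nat \<Rightarrow> (nat \<Rightarrow> 'a::frechet_algebra) \<Rightarrow> (nat \<Rightarrow> 'a) \<Rightarrow> real" where
  "tdist N m a b = (\<Sum>j<m. \<Sum>i<N. seminorms i (a j - b j))"

lemma tdist_triangle: "tdist N m a c \<le> tdist N m a b + tdist N m b c"
proof -
  have "seminorms i (a j - c j) \<le> seminorms i (a j - b j) + seminorms i (b j - c j)" for i j
    using seminorms_triangle[of i "a j - b j" "b j - c j"] by simp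
  then show ?thesis
    unfolding tdist_def by (simp add: sum_mono flip: sum.distrib)
qed

lemma tdist_commute: "tdist N m a b = tdist N m b a"
  unfolding tdist_def by (simp only: seminorms_minus_commute)

lemma tdist_self [simp]: "tdist N m a a = 0"
  by (simp add: tdist_def)

lemma tdist_mono: "N \<le> M \<Longrightarrow> tdist N m a b \<le> tdist M m a b"
  unfolding tdist_def by (intro sum_mono sum_mono2) auto

lemma seminorms_le_tdist: "j < m \<Longrightarrow> i < N \<Longrightarrow> seminorms i (a j - b j) \<le> tdist N m a b"
proof -
  assume "j < m" "i < N"
  then have "seminorms i (a j - b j) \<le> (\<Sum>i<N. seminorms i (a j - b j))"
    by (intro member_le_sum) auto
  also have "\<dots> \<le> tdist N m a b"
    unfolding tdist_def
    using \<open>j < m\<close> by (intro member_le_sum[where f = "\<lambda>j. \<Sum>i<N. seminorms i (a j - b j)"]) (auto intro: sum_nonneg)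
  finally show ?thesis .
qed

text \<open>Local convexity enters here. As the weights sum to 1, \<open>b j\<close> is the weighted
  mean of copies of itself, and the triangle inequality applies to the weighted differences.\<close>

lemma tdist_convex:
  fixes x :: "'l \<Rightarrow> nat \<Rightarrow> 'a::frechet_algebra"
  assumes "\<And>l. l \<in> L \<Longrightarrow> 0 \<le> w l" "(\<Sum>l\<in>L. w l) = 1"
  shows "tdist N m (\<lambda>j. \<Sum>l\<in>L. scaleC (of_real (w l)) (x l j)) b \<le> (\<Sum>l\<in>L. w l * tdist N m (x l) b)"
proof -
  have le: "seminorms i ((\<Sum>l\<in>L. scaleC (of_real (w l)) (x l j)) - b j) \<le>
      (\<Sum>l\<in>L. w l * seminorms i (x l j - b j))" for i j
  proof -
    have "b j = scaleC (of_real (\<Sum>l\<in>L. w l)) (b j)"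
      by (simp add: assms(2) scaleC_one)
    also have "\<dots> = (\<Sum>l\<in>L. scaleC (of_real (w l)) (b j))"
      by (simp add: scaleC_sum_left)
    finally have "(\<Sum>l\<in>L. scaleC (of_real (w l)) (x l j)) - b j =
        (\<Sum>l\<in>L. scaleC (of_real (w l)) (x l j - b j))"
      by (simp add: scaleC_diff_right sum_subtractf)
    also have "seminorms i \<dots> \<le> (\<Sum>l\<in>L. seminorms i (scaleC (of_real (w l)) (x l j - b j)))"
      by (rule seminorms_sum)
    also have "\<dots> = (\<Sum>l\<in>L. w l * seminorms i (x l j - b j))"
      by (intro sum.cong refl) (simp add: seminorms_scaleC assms(1))
    finally show ?thesis .
  qed
  have "tdist N m (\<lambda>j. \<Sum>l\<in>L. scaleC (of_real (w l)) (x l j)) b \<le>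
      (\<Sum>j<m. \<Sum>i<N. \<Sum>l\<in>L. w l * seminorms i (x l j - b j))"
    unfolding tdist_def by (intro sum_mono le)
  also have "\<dots> = (\<Sum>j<m. \<Sum>l\<in>L. \<Sum>i<N. w l * seminorms i (x l j - b j))"
    by (intro sum.cong refl sum.swap)
  also have "\<dots> = (\<Sum>l\<in>L. \<Sum>j<m. \<Sum>i<N. w l * seminorms i (x l j - b j))"
    by (rule sum.swap)
  finally show ?thesis
    by (simp add: tdist_def sum_distrib_left)
qed

lemma continuous_map_tuplesD:
  "continuous_map K (tuples m) f \<Longrightarrow> j < m \<Longrightarrow> continuous_map K euclidean (\<lambda>k. f k j)"
  by (simp add: continuous_map_componentwise)

lemma continuous_map_tuplesI:
  assumes "\<And>j. j < m \<Longrightarrow> continuous_map K euclidean (\<lambda>k. f k j)"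
  shows "continuous_map K (tuples m) (\<lambda>k. \<lambda>j\<in>{..<m}. f k j)"
  using assms by (auto simp: continuous_map_componentwise)

lemma continuous_map_tdist:
  fixes f :: "'k \<Rightarrow> nat \<Rightarrow> 'a::frechet_algebra"
  assumes "continuous_map K (tuples m) f"
  shows "continuous_map K euclideanreal (\<lambda>k. tdist N m (f k) b)"
  unfolding tdist_def
  by (intro continuous_map_sum continuous_map_seminorms_diff continuous_map_tuplesD[OF assms]) auto

lemma openin_tuples_box:
  assumes "openin (tuples m) W" "v \<in> W"
  obtains U where "\<And>j. j < m \<Longrightarrow> open (U j)" "v \<in> PiE {..<m} U" "PiE {..<m} U \<subseteq> W"
proof -
  have "\<exists>U. (\<forall>j\<in>{..<m}. open (U j)) \<and> v \<in> PiE {..<m} U \<and> PiE {..<m} U \<subseteq> W"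
    using assms by (simp add: openin_product_topology_alt)
  then show thesis
    using that by (metis lessThan_iff)
qed

text \<open>A box neighbourhood gives a number of seminorms and a radius for each coordinate; the
  sum of the former and the minimum of the latter serve all coordinates. Extensionality is required
  of \<open>w\<close> because \<open>tdist\<close> does not see values outside
  \<open>{..<m}\<close>.\<close>

lemma openin_tuples_ball:
  fixes v :: "nat \<Rightarrow> 'a::frechet_algebra"
  assumes "openin (tuples m) W" "v \<in> W"
  shows "\<exists>N e. e > 0 \<and> (\<forall>w\<in>extensional {..<m}. tdist N m w v < e \<longrightarrow> w \<in> W)"
proof -
  obtain U where U: "\<And>j. j < m \<Longrightarrow> open (U j)" "v \<in> PiE {..<m} U" "PiE {..<m} U \<subseteq> W"
    using openin_tuples_box[OF assms(1,2)] by blast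
  have "\<forall>j\<in>{..<m}. \<exists>N e. e > 0 \<and> (\<forall>y. (\<forall>i<N. seminorms i (y - v j) < e) \<longrightarrow> y \<in> U j)"
  proof
    fix j assume "j \<in> {..<m}"
    then have "open (U j)" "v j \<in> U j" using U by auto
    then show "\<exists>N e. e > 0 \<and> (\<forall>y. (\<forall>i<N. seminorms i (y - v j) < e) \<longrightarrow> y \<in> U j)"
      unfolding open_seminorms by blast
  qed
  then obtain N e where Ne: "\<And>j. j < m \<Longrightarrow> e j > 0"
    "\<And>j y. j < m \<Longrightarrow> (\<And>i. i < N j \<Longrightarrow> seminorms i (y - v j) < e j) \<Longrightarrow> y \<in> U j"
    unfolding bchoice_iff by (metis lessThan_iff)
  \<comment> \<open>The 1 keeps the minimum defined when \<open>m\<close> is 0.\<close>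
  define d where "d = Min (insert 1 (e ` {..<m}))"
  have "d > 0"
    using Ne(1) by (auto simp: d_def)
  moreover have "w \<in> W" if w: "w \<in> extensional {..<m}" "tdist (\<Sum>j<m. N j) m w v < d" for w
  proof -
    have "w j \<in> U j" if j: "j < m" for j
    proof (rule Ne(2)[OF j])
      fix i assume i: "i < N j"
      have "N j \<le> (\<Sum>j<m. N j)"
        using j by (intro member_le_sum) auto
      then have "seminorms i (w j - v j) \<le> tdist (\<Sum>j<m. N j) m w v"
        using i j by (intro seminorms_le_tdist) auto
      moreover have "d \<le> e j"
        using j by (auto simp: d_def intro!: Min_le)
      ultimately show "seminorms i (w j - v j) < e j"
        using w by linarith
    qed
    then show ?thesis using w U(3) by (auto simp: PiE_def)
  qed
  ultimately show ?thesis by blast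
qed

lemma dense_tuples_meet_open:
  assumes "openin (tuples m) W" "v \<in> W" "closure D = UNIV"
  shows "\<exists>y\<in>PiE {..<m} (\<lambda>_. D). y \<in> W"
proof -
  obtain U where U: "\<And>j. j < m \<Longrightarrow> open (U j)" "v \<in> PiE {..<m} U" "PiE {..<m} U \<subseteq> W"
    using openin_tuples_box[OF assms(1,2)] by blast
  have "\<forall>j\<in>{..<m}. \<exists>y. y \<in> D \<inter> U j"
  proof
    fix j assume "j \<in> {..<m}"
    then have "open (U j)" "v j \<in> U j" using U by auto
    then show "\<exists>y. y \<in> D \<inter> U j"
      using assms(3) open_Int_closure_eq_empty[of "U j" D] by auto
  qed
  then obtain y where "\<And>j. j < m \<Longrightarrow> y j \<in> D \<inter> U j"
    unfolding bchoice_iff by auto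
  then have "restrict y {..<m} \<in> PiE {..<m} U" "restrict y {..<m} \<in> PiE {..<m} (\<lambda>_. D)"
    by auto
  then show ?thesis
    using U(3) by blast
qed

lemma compact_space_finite_subcover:
  assumes "compact_space K" "\<And>i. i \<in> I \<Longrightarrow> openin K (U i)" "topspace K \<subseteq> (\<Union>i\<in>I. U i)"
  obtains J where "finite J" "J \<subseteq> I" "topspace K \<subseteq> (\<Union>i\<in>J. U i)"
proof -
  have "\<exists>F. finite F \<and> F \<subseteq> U ` I \<and> topspace K \<subseteq> \<Union>F"
    using assms unfolding compact_space_alt by (metis (no_types, lifting) imageE)
  then show thesis
    using that by (metis finite_subset_image)
qed

text \<open>A Lebesgue number argument: preimages of the half-radius balls have a finite subcover,
  and the least half radius, with the sum of the seminorm counts, works everywhere by the triangle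
  inequality.\<close>

lemma compact_image_uniform_ball:
  fixes f :: "'k \<Rightarrow> nat \<Rightarrow> 'a::frechet_algebra"
  assumes K: "compact_space K" and f: "continuous_map K (tuples m) f"
    and W: "openin (tuples m) W" "f ` topspace K \<subseteq> W"
  shows "\<exists>N e. e > 0 \<and>
    (\<forall>k\<in>topspace K. \<forall>w\<in>extensional {..<m}. tdist N m w (f k) < e \<longrightarrow> w \<in> W)"
proof -
  have "\<forall>k\<in>topspace K. \<exists>N e. e > 0 \<and>
      (\<forall>w\<in>extensional {..<m}. tdist N m w (f k) < e \<longrightarrow> w \<in> W)"
    using W(2) by (intro ballI openin_tuples_ball[OF W(1)]) auto
  then obtain N e where Ne: "\<And>k. k \<in> topspace K \<Longrightarrow> e k > 0"
    "\<And>k w. k \<in> topspace K \<Longrightarrow> w \<in> extensional {..<m} \<Longrightarrow> tdist (N k) m w (f k) < e k \<Longrightarrow> w \<in> W"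
    unfolding bchoice_iff by metis
  define U where "U k = {k' \<in> topspace K. tdist (N k) m (f k') (f k) \<in> {..<e k / 2}}" for k
  have "openin K (U k)" if "k \<in> topspace K" for k
    unfolding U_def by (rule openin_continuous_map_preimage[OF continuous_map_tdist[OF f]]) simp
  moreover have "topspace K \<subseteq> (\<Union>k\<in>topspace K. U k)"
    using Ne(1) by (auto simp: U_def)
  ultimately obtain J where J: "finite J" "J \<subseteq> topspace K" "topspace K \<subseteq> (\<Union>k\<in>J. U k)"
    by (rule compact_space_finite_subcover[OF K])
  \<comment> \<open>\<open>J\<close> may be empty when \<open>K\<close> is; the 1 covers that
    case.\<close>
  define d where "d = Min (insert 1 ((\<lambda>k. e k / 2) ` J))"
  have "d > 0"
    using Ne(1) J by (auto simp: d_def)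
  moreover have "w \<in> W"
    if k: "k \<in> topspace K" and w: "w \<in> extensional {..<m}" "tdist (\<Sum>k\<in>J. N k) m w (f k) < d" for k w
  proof -
    obtain l where l: "l \<in> J" "k \<in> U l" using J k by blast
    have "N l \<le> (\<Sum>k\<in>J. N k)"
      using l J by (intro member_le_sum) auto
    then have "tdist (N l) m w (f k) \<le> tdist (\<Sum>k\<in>J. N k) m w (f k)"
      by (rule tdist_mono)
    moreover have "d \<le> e l / 2"
      unfolding d_def using l J by (intro Min_le) auto
    moreover have "tdist (N l) m (f k) (f l) < e l / 2"
      using l by (simp add: U_def)
    ultimately have "tdist (N l) m w (f l) < e l"
      using tdist_triangle[of "N l" m w "f l" "f k"] w(2) by linarith
    then show ?thesis
      using Ne(2) l J w by blast
  qed
  ultimately show ?thesis by blast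
qed

text \<open>The restriction makes the segment extensional even if its ends are not, as happens for
  the end \<open>\<lambda>j. \<phi> (g k j)\<close> below.\<close>

definition tsegment ::
  "nat \<Rightarrow> real \<Rightarrow> (nat \<Rightarrow> 'a::complex_unital_algebra) \<Rightarrow> (nat \<Rightarrow> 'a) \<Rightarrow> nat \<Rightarrow> 'a" where
  "tsegment m t a b =
     (\<lambda>j\<in>{..<m}. scaleC (of_real (1 - t)) (a j) + scaleC (of_real t) (b j))"

lemma tdist_tsegment:
  fixes a b :: "nat \<Rightarrow> 'a::frechet_algebra"
  assumes "t \<in> {0..1}"
  shows "tdist N m (tsegment m t a b) a \<le> tdist N m b a"
proof -
  have "seminorms i (tsegment m t a b j - a j) \<le> seminorms i (b j - a j)" if "j < m" for i j
  proof -
    have "tsegment m t a b j - a j = scaleC (of_real t) (b j - a j)"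
      using that by (simp add: tsegment_def scaleC_diff_left scaleC_diff_right scaleC_one)
    then show ?thesis
      using assms by (simp add: seminorms_scaleC mult_left_le_one_le)
  qed
  then show ?thesis
    unfolding tdist_def by (intro sum_mono) auto
qed

text \<open>A partition of unity by hand: the weight of a tuple \<open>x\<close> vanishes where its image is not
  close to \<open>f\<close>, so the weighted mean of the images stays close to \<open>f\<close>.\<close>

lemma approximate_by_dense_subspace:
  fixes \<phi> :: "'a::frechet_algebra \<Rightarrow> 'b::frechet_algebra" and f :: "'k \<Rightarrow> nat \<Rightarrow> 'b"
  assumes add: "\<And>x y. \<phi> (x + y) = \<phi> x + \<phi> y" and scale: "\<And>c x. \<phi> (scaleC c x) = scaleC c (\<phi> x)"
    and dense: "closure (\<phi> ` X) = UNIV"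
    and X: "0 \<in> X" "\<And>x y. x \<in> X \<Longrightarrow> y \<in> X \<Longrightarrow> x + y \<in> X" "\<And>c x. x \<in> X \<Longrightarrow> scaleC c x \<in> X"
    and K: "compact_space K" and f: "continuous_map K (tuples m) f"
    and W: "openin (tuples m) W" "f ` topspace K \<subseteq> W"
  obtains g where "continuous_map K (tuples m) g"
    "\<And>k. k \<in> topspace K \<Longrightarrow> g k \<in> PiE {..<m} (\<lambda>_. X)"
    "\<And>k t. k \<in> topspace K \<Longrightarrow> t \<in> {0..1} \<Longrightarrow> tsegment m t (f k) (\<lambda>j. \<phi> (g k j)) \<in> W"
proof -
  obtain N e where "e > 0" and ball: "\<And>k w. k \<in> topspace K \<Longrightarrow> w \<in> extensional {..<m} \<Longrightarrow>
      tdist N m w (f k) < e \<Longrightarrow> w \<in> W"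
    using compact_image_uniform_ball[OF K f W] by blast
  define h where "h x k = tdist N m (f k) (\<lambda>j. \<phi> (x j))" for x k
  have h: "continuous_map K euclideanreal (h x)" for x
    unfolding h_def by (rule continuous_map_tdist[OF f])
  \<comment> \<open>Half the radius, because averaging only yields the weak bound
    \<open>e/2\<close>, while \<open>ball\<close> asks for a strict bound by
    \<open>e\<close>.\<close>
  define U where "U x = {k \<in> topspace K. h x k \<in> {..<e/2}}" for x
  have "openin K (U x)" for x
    unfolding U_def by (rule openin_continuous_map_preimage[OF h]) simp
  moreover have "topspace K \<subseteq> (\<Union>x\<in>PiE {..<m} (\<lambda>_. X). U x)"
  proof
    fix k assume k: "k \<in> topspace K"
    have "f k \<in> topspace (tuples m)"
      using continuous_map_image_subset_topspace[OF f] k by blast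
    let ?B = "{w \<in> topspace (tuples m). tdist N m w (f k) \<in> {..<e/2}}"
    have "continuous_map (tuples m) euclideanreal (\<lambda>w. tdist N m w (f k))"
      by (rule continuous_map_tdist) (rule continuous_map_id[unfolded id_def])
    then have "openin (tuples m) ?B"
      by (rule openin_continuous_map_preimage) simp
    moreover have "f k \<in> ?B"
      using \<open>f k \<in> topspace (tuples m)\<close> \<open>e > 0\<close> by simp
    ultimately obtain y where y: "y \<in> PiE {..<m} (\<lambda>_. \<phi> ` X)" "y \<in> ?B"
      using dense_tuples_meet_open[OF _ _ dense] by blast
    have "\<forall>j\<in>{..<m}. \<exists>x. x \<in> X \<and> y j = \<phi> x"
      using y(1) by (auto simp: PiE_iff image_iff)
    then obtain x where x: "\<And>j. j < m \<Longrightarrow> x j \<in> X" "\<And>j. j < m \<Longrightarrow> y j = \<phi> (x j)"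
      unfolding bchoice_iff by (metis lessThan_iff)
    have "h (restrict x {..<m}) k = tdist N m y (f k)"
      unfolding h_def tdist_commute[of N m y] unfolding tdist_def
      by (intro sum.cong refl) (simp add: x)
    then have "k \<in> U (restrict x {..<m})"
      using y k by (simp add: U_def)
    then show "k \<in> (\<Union>x\<in>PiE {..<m} (\<lambda>_. X). U x)"
      using x by (intro UN_I[of "restrict x {..<m}"]) auto
  qed
  ultimately obtain L where L: "finite L" "L \<subseteq> PiE {..<m} (\<lambda>_. X)" "topspace K \<subseteq> (\<Union>x\<in>L. U x)"
    by (rule compact_space_finite_subcover[OF K])
  \<comment> \<open>A tent function, positive on \<open>topspace K\<close> exactly where
    \<open>U x\<close> is; as the sets \<open>U x\<close> for \<open>x\<close> in \<open>L\<close>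
    cover, the normalising sum \<open>s\<close> is positive.\<close>
  define u where "u x k = max 0 (e/2 - h x k)" for x k
  define s where "s k = (\<Sum>x\<in>L. u x k)" for k
  define w where "w x k = u x k / s k" for x k
  have s: "s k > 0" if k: "k \<in> topspace K" for k
  proof -
    obtain x where "x \<in> L" "k \<in> U x" using L(3) k by blast
    then show ?thesis
      unfolding s_def using L by (intro sum_pos2[of L x]) (auto simp: u_def U_def)
  qed
  have u_cont: "continuous_map K euclideanreal (u x)" for x
    unfolding u_def by (intro continuous_intros h)
  have s_cont: "continuous_map K euclideanreal s"
    unfolding s_def by (intro continuous_map_sum u_cont L)
  have w_cont: "continuous_map K euclideanreal (w x)" for x
    unfolding w_def using s by (intro continuous_map_real_divide u_cont s_cont) force
  have w_nonneg: "0 \<le> w x k" if "k \<in> topspace K" for x k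
    unfolding w_def using s[OF that] by (simp add: u_def)
  have w_sum: "(\<Sum>x\<in>L. w x k) = 1" if "k \<in> topspace K" for k
    unfolding w_def using s[OF that] by (simp add: s_def flip: sum_divide_distrib)
  define g where "g k = (\<lambda>j\<in>{..<m}. \<Sum>x\<in>L. scaleC (of_real (w x k)) (x j))" for k
  have "continuous_map K (tuples m) g"
    unfolding g_def
    by (intro continuous_map_tuplesI continuous_map_sum_frechet continuous_map_scaleC w_cont) simp
  moreover have "g k \<in> PiE {..<m} (\<lambda>_. X)" for k
  proof -
    have "(\<Sum>x\<in>L'. scaleC (of_real (w x k)) (x j)) \<in> X" if "j < m" "L' \<subseteq> L" for j L'
      using finite_subset[OF that(2) L(1)] that(2)
    proof (induction L' rule: finite_induct)
      case (insert x L')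
      then have "x j \<in> X" using L(2) that(1) by auto
      then show ?case using insert X by simp
    qed (simp add: X)
    then show ?thesis by (auto simp: g_def)
  qed
  moreover have "tsegment m t (f k) (\<lambda>j. \<phi> (g k j)) \<in> W" if k: "k \<in> topspace K" and t: "t \<in> {0..1}" for k t
  proof (rule ball[OF k])
    have zero: "\<phi> 0 = 0"
      using add[of 0 0] by simp
    have phi_sum: "\<phi> (\<Sum>x\<in>S. F x) = (\<Sum>x\<in>S. \<phi> (F x))" for F :: "(nat \<Rightarrow> 'a) \<Rightarrow> 'a" and S
      by (induction S rule: infinite_finite_induct) (simp_all add: zero add)
    \<comment> \<open>No point of the segment is further from \<open>f k\<close> than the other end
      is, so only that end has to be estimated.\<close>
    have "tdist N m (tsegment m t (f k) (\<lambda>j. \<phi> (g k j))) (f k) \<le> tdist N m (\<lambda>j. \<phi> (g k j)) (f k)"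
      by (rule tdist_tsegment[OF t])
    also have "\<dots> = tdist N m (\<lambda>j. \<Sum>x\<in>L. scaleC (of_real (w x k)) (\<phi> (x j))) (f k)"
      unfolding tdist_def by (intro sum.cong refl) (simp add: g_def phi_sum scale)
    also have "\<dots> \<le> (\<Sum>x\<in>L. w x k * tdist N m (\<lambda>j. \<phi> (x j)) (f k))"
      by (rule tdist_convex) (use k w_nonneg w_sum in auto)
    also have "\<dots> \<le> (\<Sum>x\<in>L. w x k * (e/2))"
    proof (rule sum_mono)
      fix x
      \<comment> \<open>A summand either has weight zero or belongs to a tuple whose image is within
        \<open>e/2\<close> of \<open>f k\<close>.\<close>
      have "w x k = 0" if "h x k > e/2"
        using that by (simp add: u_def w_def)
      then show "w x k * tdist N m (\<lambda>j. \<phi> (x j)) (f k) \<le> w x k * (e/2)"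
        using w_nonneg[OF k, of x] unfolding tdist_commute[of N m _ "f k"] h_def[symmetric]
        by (cases "h x k > e/2") (simp, intro mult_left_mono, simp_all)
    qed
    also have "\<dots> = e/2"
      unfolding sum_distrib_right[symmetric] w_sum[OF k] by simp
    also have "\<dots> < e" using \<open>e > 0\<close> by simp
    finally show "tdist N m (tsegment m t (f k) (\<lambda>j. \<phi> (g k j))) (f k) < e" .
  qed (simp add: tsegment_def)
  ultimately show thesis using that by blast
qed

section \<open>Unimodular tuples\<close>

text \<open>A left ideal is everything once it contains 1: multiply the coefficients by
  \<open>y\<close> from the left.\<close>

lemma Lg_iff: "a \<in> Lg m \<longleftrightarrow> a \<in> extensional {..<m} \<and> (\<exists>c. (\<Sum>i<m. c i * a i) = 1)"
proof
  assume "a \<in> Lg m"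
  then have "a \<in> extensional {..<m}" "1 \<in> range (\<lambda>c :: nat \<Rightarrow> 'a. \<Sum>i<m. c i * a i)"
    by (auto simp: Lg_def PiE_def)
  then show "a \<in> extensional {..<m} \<and> (\<exists>c. (\<Sum>i<m. c i * a i) = 1)"
    by (auto dest: sym)
next
  assume *: "a \<in> extensional {..<m} \<and> (\<exists>c. (\<Sum>i<m. c i * a i) = 1)"
  then obtain c where c: "(\<Sum>i<m. c i * a i) = 1" by blast
  have "y \<in> range (\<lambda>c :: nat \<Rightarrow> 'a. \<Sum>i<m. c i * a i)" for y
  proof (rule range_eqI)
    have "y = y * (\<Sum>i<m. c i * a i)" by (simp add: c)
    also have "\<dots> = (\<Sum>i<m. (y * c i) * a i)"
      by (simp add: sum_distrib_left mult.assoc)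
    finally show "y = (\<Sum>i<m. (y * c i) * a i)" .
  qed
  then show "a \<in> Lg m"
    using * by (auto simp: Lg_def PiE_def)
qed

text \<open>A left inverse is absorbed into the coefficients. With invertibility in place of
  equality to 1, the condition survives small perturbations of the tuple or of the
  coefficients.\<close>

lemma Lg_if_invertible:
  assumes "a \<in> extensional {..<m}" "(\<Sum>i<m. c i * a i) \<in> invertibles"
  shows "a \<in> Lg m"
proof -
  obtain b where "b * (\<Sum>i<m. c i * a i) = 1"
    using assms(2) by (auto simp: invertibles_def)
  then have "(\<Sum>i<m. (b * c i) * a i) = 1"
    by (simp add: sum_distrib_left mult.assoc)
  then show ?thesis
    using assms(1) unfolding Lg_iff by (intro conjI exI[of _ "\<lambda>i. b * c i"])
qed

lemma one_in_invertibles: "1 \<in> invertibles"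
  by (auto simp: invertibles_def)

text \<open>At 0 the spectrum tests invertibility of \<open>- a\<close> rather than
  \<open>a\<close>.\<close>

lemma minus_invertible_iff: "- y \<in> invertibles \<longleftrightarrow> y \<in> invertibles"
proof -
  have "- z \<in> invertibles" if z: "z \<in> invertibles" for z :: 'a
  proof -
    obtain b where "z * b = 1" "b * z = 1"
      using z by (auto simp: invertibles_def)
    then have "- z * - b = 1 \<and> - b * - z = 1" by simp
    then show ?thesis unfolding invertibles_def by blast
  qed
  from this[of y] this[of "- y"] show ?thesis by auto
qed

text \<open>Coefficients that work for \<open>a\<close> are kept; tuples for which the same
  combination is still invertible form an open set around \<open>a\<close>.\<close>

lemma openin_Lg:
  assumes "open (invertibles :: 'a::frechet_algebra set)"
  shows "openin (tuples m) (Lg m :: (nat \<Rightarrow> 'a) set)"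
proof (subst openin_subopen, intro ballI)
  fix a :: "nat \<Rightarrow> 'a" assume a: "a \<in> Lg m"
  then obtain c where c: "(\<Sum>i<m. c i * a i) = 1" and ext: "a \<in> extensional {..<m}"
    unfolding Lg_iff by blast
  let ?T = "{x \<in> topspace (tuples m). (\<Sum>i<m. c i * x i) \<in> invertibles}"
  have "continuous_map (tuples m) euclidean (\<lambda>x :: nat \<Rightarrow> 'a. \<Sum>i<m. c i * x i)"
    by (intro continuous_map_sum_frechet continuous_map_mult_left_frechet
        continuous_map_product_projection) auto
  then have "openin (tuples m) ?T"
    by (rule openin_continuous_map_preimage) (use assms in simp)
  moreover have "a \<in> ?T"
    using ext by (simp add: c one_in_invertibles PiE_def)
  moreover have "?T \<subseteq> Lg m"
    using Lg_if_invertible by (auto simp: PiE_def)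
  ultimately show "\<exists>T. openin (tuples m) T \<and> a \<in> T \<and> T \<subseteq> Lg m"
    by blast
qed

lemma continuous_map_Lg_space:
  "continuous_map K (Lg_space m) f \<longleftrightarrow> continuous_map K (tuples m) f \<and> f ` topspace K \<subseteq> Lg m"
  by (auto simp: Lg_space_def continuous_map_in_subtopology)

text \<open>The first unit vector serves as its own coefficients. For \<open>m\<close> equal to 0
  the sum is empty, and 0 equals 1 only in the zero algebra.\<close>

lemma Lg_space_nonempty:
  assumes "m \<ge> 1"
  shows "topspace (Lg_space m :: (nat \<Rightarrow> 'a::{complex_unital_algebra, topological_space}) topology) \<noteq> {}"
proof -
  let ?a = "\<lambda>i\<in>{..<m}. if i = 0 then 1 else 0 :: 'a"
  have "(\<Sum>i<m. ?a i * ?a i) = (\<Sum>i\<in>{0}. ?a i * ?a i)"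
    using assms by (intro sum.mono_neutral_right) auto
  also have "\<dots> = 1"
    using assms by simp
  finally have "?a \<in> Lg m"
    unfolding Lg_iff by auto
  moreover have "?a \<in> topspace (tuples m)"
    by (simp add: PiE_def)
  ultimately have "?a \<in> topspace (Lg_space m)"
    by (simp only: Lg_space_def topspace_subtopology Int_iff)
  then show ?thesis by blast
qed

lemma homotopic_with_Lg_segment:
  fixes f g :: "'k \<Rightarrow> nat \<Rightarrow> 'a::frechet_algebra"
  assumes f: "continuous_map K (tuples m) f" and g: "continuous_map K (tuples m) g"
    and seg: "\<And>k t. k \<in> topspace K \<Longrightarrow> t \<in> {0..1} \<Longrightarrow> tsegment m t (f k) (g k) \<in> Lg m"
  shows "homotopic_with (\<lambda>_. True) K (Lg_space m) f g"
proof (subst homotopic_with, simp, intro exI conjI ballI)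
  let ?K = "prod_topology (top_of_set {0..1::real}) K"
  let ?h = "\<lambda>z. tsegment m (fst z) (f (snd z)) (g (snd z))"
  have time: "continuous_map ?K euclideanreal fst"
    using continuous_map_fst continuous_map_into_fulltopology by blast
  have comp: "continuous_map ?K euclidean (\<lambda>z. f (snd z) j)"
    "continuous_map ?K euclidean (\<lambda>z. g (snd z) j)" if "j < m" for j
    using continuous_map_compose[OF continuous_map_snd continuous_map_tuplesD[OF f that]]
      continuous_map_compose[OF continuous_map_snd continuous_map_tuplesD[OF g that]]
    by (simp_all add: o_def)
  have "continuous_map ?K (tuples m) ?h"
    unfolding tsegment_def
    by (intro continuous_map_tuplesI continuous_map_add_frechet continuous_map_scaleC comp
        continuous_intros time) auto
  then show "continuous_map ?K (Lg_space m) ?h"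
    using seg by (auto simp: continuous_map_Lg_space)
  \<comment> \<open>\<open>tsegment\<close> returns its ends at times 0 and 1 only if they are
    extensional.\<close>
  have ext: "f k \<in> extensional {..<m}" "g k \<in> extensional {..<m}" if "k \<in> topspace K" for k
    using continuous_map_image_subset_topspace[OF f] continuous_map_image_subset_topspace[OF g] that
    by (auto simp: PiE_def)
  show "?h (0, k) = f k" if "k \<in> topspace K" for k
    using ext[OF that] by (auto simp: tsegment_def scaleC_one fun_eq_iff extensional_def)
  show "?h (1, k) = g k" if "k \<in> topspace K" for k
    using ext[OF that] by (auto simp: tsegment_def scaleC_one fun_eq_iff extensional_def)
qed simp

lemma homotopic_with_time_slices:
  assumes "continuous_map (prod_topology (top_of_set {0..1::real}) K) T G"
  shows "homotopic_with (\<lambda>_. True) K T (\<lambda>k. G (0, k)) (\<lambda>k. G (1, k))"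
  unfolding homotopic_with_def using assms by blast

section \<open>Transfer along a relatively spectral morphism\<close>

locale relatively_spectral_morphism =
  fixes \<phi> :: "'a::frechet_algebra \<Rightarrow> 'b::frechet_algebra" and X :: "'a set"
  assumes open_A: "open (invertibles :: 'a set)" and open_B: "open (invertibles :: 'b set)"
    and morphism: "algebra_morphism \<phi>" and dense_range: "dense_morphism \<phi>"
    and subalgebra: "unital_subalgebra X" and dense_X: "closure X = UNIV"
    and spectra: "\<And>x. x \<in> X \<Longrightarrow> alg_spectrum (\<phi> x) = alg_spectrum x"
begin

lemma hom: "\<phi> (x + y) = \<phi> x + \<phi> y" "\<phi> (scaleC c x) = scaleC c (\<phi> x)"
    "\<phi> (x * y) = \<phi> x * \<phi> y" "\<phi> 1 = 1"
  using morphism by (auto simp: algebra_morphism_def unital_algebra_hom_def)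

lemma hom_zero: "\<phi> 0 = 0"
  using hom(1)[of 0 0] by simp

lemma hom_sum: "\<phi> (\<Sum>x\<in>S. F x) = (\<Sum>x\<in>S. \<phi> (F x))"
  by (induction S rule: infinite_finite_induct) (simp_all add: hom_zero hom)

lemma X_closed: "1 \<in> X" "x \<in> X \<Longrightarrow> y \<in> X \<Longrightarrow> x + y \<in> X"
    "x \<in> X \<Longrightarrow> y \<in> X \<Longrightarrow> x * y \<in> X" "x \<in> X \<Longrightarrow> scaleC c x \<in> X"
  using subalgebra by (auto simp: unital_subalgebra_def)

lemma zero_in_X: "0 \<in> X"
  using X_closed(4)[OF X_closed(1), of 0] by simp

text \<open>Continuity makes the image of \<open>X\<close> dense in the range, which is itself
  dense.\<close>

lemma dense_image: "closure (\<phi> ` X) = UNIV"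
proof -
  have "\<phi> ` closure X \<subseteq> closure (\<phi> ` X)"
    using morphism by (intro image_closure_subset)
      (auto simp: algebra_morphism_def dense_X closure_subset)
  then have "closure (range \<phi>) \<subseteq> closure (\<phi> ` X)"
    by (simp add: dense_X closure_minimal)
  then show ?thesis
    using dense_range by (auto simp: dense_morphism_def)
qed

text \<open>Invertibility means that 0 is not in the spectrum, and the spectra of \<open>x\<close>
  and \<open>\<phi> x\<close> agree.\<close>

lemma invertible_reflect:
  assumes "x \<in> X" "\<phi> x \<in> invertibles"
  shows "x \<in> invertibles"
proof -
  have "0 \<notin> alg_spectrum (\<phi> x)"
    using assms(2) by (simp add: alg_spectrum_def minus_invertible_iff)
  then have "0 \<notin> alg_spectrum x"
    by (simp only: spectra[OF assms(1)] not_False_eq_True)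
  then show ?thesis
    by (simp add: alg_spectrum_def minus_invertible_iff)
qed

text \<open>The coefficients witnessing unimodularity of the image may be perturbed into \<open>\<phi> ` X\<close>, since
  the combination they give only has to be invertible.\<close>

lemma Lg_reflect:
  assumes x: "x \<in> PiE {..<m} (\<lambda>_. X)" and Lg: "(\<lambda>j\<in>{..<m}. \<phi> (x j)) \<in> Lg m"
  shows "x \<in> Lg m"
proof -
  obtain c where "(\<Sum>i<m. c i * (\<lambda>j\<in>{..<m}. \<phi> (x j)) i) = 1"
    using Lg unfolding Lg_iff by blast
  then have c: "(\<Sum>i<m. c i * \<phi> (x i)) = 1" by simp
  let ?T = "{c \<in> topspace (tuples m). (\<Sum>i<m. c i * \<phi> (x i)) \<in> invertibles}"
  have "continuous_map (tuples m) euclidean (\<lambda>c. \<Sum>i<m. c i * \<phi> (x i))"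
    by (intro continuous_map_sum_frechet continuous_map_mult_right_frechet
        continuous_map_product_projection) auto
  then have "openin (tuples m) ?T"
    by (rule openin_continuous_map_preimage) (use open_B in simp)
  moreover have "restrict c {..<m} \<in> ?T"
    using c one_in_invertibles by simp
  ultimately obtain y where y: "y \<in> PiE {..<m} (\<lambda>_. \<phi> ` X)" "y \<in> ?T"
    using dense_tuples_meet_open[OF _ _ dense_image] by blast
  have "\<forall>j\<in>{..<m}. \<exists>z. z \<in> X \<and> y j = \<phi> z"
    using y(1) by (auto simp: PiE_iff image_iff)
  then obtain z where z: "\<And>j. j < m \<Longrightarrow> z j \<in> X" "\<And>j. j < m \<Longrightarrow> y j = \<phi> (z j)"
    unfolding bchoice_iff by (metis lessThan_iff)
  \<comment> \<open>\<open>invertible_reflect\<close> needs the combination itself to lie in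
    \<open>X\<close>, which is why both the tuple and the new coefficients are taken from
    there.\<close>
  have "(\<Sum>i<m'. z i * x i) \<in> X" if "m' \<le> m" for m'
    using that
  proof (induction m')
    case (Suc m')
    then have "z m' \<in> X" "x m' \<in> X"
      using z(1) x by auto
    then show ?case using Suc by (simp add: X_closed(2,3))
  qed (simp add: zero_in_X)
  then have "(\<Sum>i<m. z i * x i) \<in> X" by simp
  moreover have "\<phi> (\<Sum>i<m. z i * x i) \<in> invertibles"
    using y(2) by (simp add: hom_sum hom z)
  ultimately have "(\<Sum>i<m. z i * x i) \<in> invertibles"
    by (rule invertible_reflect)
  then show ?thesis
    using x by (intro Lg_if_invertible[of _ _ z]) (auto simp: PiE_def)
qed

definition push :: "nat \<Rightarrow> (nat \<Rightarrow> 'a) \<Rightarrow> nat \<Rightarrow> 'b" where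
  "push m a = (\<lambda>j\<in>{..<m}. \<phi> (a j))"

lemma push_Lg:
  assumes "a \<in> Lg m"
  shows "push m a \<in> Lg m"
proof -
  obtain c where "(\<Sum>i<m. c i * a i) = 1"
    using assms unfolding Lg_iff by blast
  from arg_cong[OF this, of \<phi>] have "(\<Sum>i<m. \<phi> (c i) * push m a i) = 1"
    by (simp add: push_def hom_sum hom)
  then show ?thesis
    unfolding Lg_iff by (intro conjI exI[of _ "\<lambda>i. \<phi> (c i)"]) (simp_all add: push_def)
qed

lemma continuous_map_push_tuples: "continuous_map (tuples m) (tuples m) (push m)"
proof -
  have "continuous_map (tuples m) euclidean (\<phi> \<circ> (\<lambda>a. a j))" if "j < m" for j
  proof (rule continuous_map_compose)
    show "continuous_map (tuples m) euclidean (\<lambda>a :: nat \<Rightarrow> 'a. a j)"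
      using that by (intro continuous_map_product_projection) simp
    show "continuous_map euclidean euclidean \<phi>"
      using morphism by (simp add: algebra_morphism_def)
  qed
  then show ?thesis
    unfolding push_def by (intro continuous_map_tuplesI) (simp add: o_def)
qed

lemma continuous_map_push: "continuous_map (Lg_space m) (Lg_space m) (push m)"
  unfolding continuous_map_Lg_space
proof
  show "continuous_map (Lg_space m) (tuples m) (push m)"
    unfolding Lg_space_def
    by (rule continuous_map_from_subtopology[OF continuous_map_push_tuples])
  have "topspace (Lg_space m :: (nat \<Rightarrow> 'a) topology) \<subseteq> Lg m"
    by (simp add: Lg_space_def)
  then show "push m ` topspace (Lg_space m) \<subseteq> Lg m"
    using push_Lg by blast
qed

text \<open>This allows \<open>Lg_reflect\<close> to be applied at every point of a segment.\<close>

lemma push_tsegment: "push m (tsegment m t a b) = tsegment m t (push m a) (push m b)"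
  by (auto simp: push_def tsegment_def hom fun_eq_iff)

lemma tsegment_push_cong: "tsegment m t b (\<lambda>j. \<phi> (a j)) = tsegment m t b (push m a)"
  by (auto simp: push_def tsegment_def fun_eq_iff)

lemma tsegment_in_X:
  assumes "a \<in> PiE {..<m} (\<lambda>_. X)" "b \<in> PiE {..<m} (\<lambda>_. X)"
  shows "tsegment m t a b \<in> PiE {..<m} (\<lambda>_. X)"
  using assms by (auto simp: tsegment_def intro!: X_closed(2,4))

lemma tsegment_one: "b \<in> extensional {..<m} \<Longrightarrow> tsegment m 1 a b = b"
  by (auto simp: tsegment_def scaleC_one fun_eq_iff extensional_def)

text \<open>Unimodular tuples over \<open>'b\<close> form an open set, so the approximating segments
  can be kept inside it. Their ends at time 1 are the images of \<open>g k\<close>, and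
  \<open>Lg_reflect\<close> turns this into unimodularity over \<open>'a\<close>.\<close>

lemma approximate_in_B:
  assumes "compact_space K" "continuous_map K (Lg_space m) f"
  obtains g where "continuous_map K (Lg_space m) g"
    "\<And>k. k \<in> topspace K \<Longrightarrow> g k \<in> PiE {..<m} (\<lambda>_. X)"
    "\<And>k t. k \<in> topspace K \<Longrightarrow> t \<in> {0..1} \<Longrightarrow> tsegment m t (f k) (push m (g k)) \<in> Lg m"
proof -
  obtain g where g: "continuous_map K (tuples m) g"
    "\<And>k. k \<in> topspace K \<Longrightarrow> g k \<in> PiE {..<m} (\<lambda>_. X)"
    "\<And>k t. k \<in> topspace K \<Longrightarrow> t \<in> {0..1} \<Longrightarrow> tsegment m t (f k) (\<lambda>j. \<phi> (g k j)) \<in> Lg m"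
  proof (rule approximate_by_dense_subspace[where \<phi> = \<phi> and X = X])
    show "continuous_map K (tuples m) f" "f ` topspace K \<subseteq> Lg m"
      using assms(2) by (auto simp: continuous_map_Lg_space)
  qed (use hom dense_image X_closed zero_in_X assms(1) openin_Lg[OF open_B] in auto)
  have seg: "tsegment m t (f k) (push m (g k)) \<in> Lg m" if "k \<in> topspace K" "t \<in> {0..1}" for k t
    using g(3)[OF that] by (simp only: tsegment_push_cong)
  have "g k \<in> Lg m" if "k \<in> topspace K" for k
  proof (rule Lg_reflect[OF g(2)[OF that]])
    have "push m (g k) \<in> Lg m"
      using seg[OF that, of 1] by (simp add: tsegment_one push_def)
    then show "(\<lambda>j\<in>{..<m}. \<phi> (g k j)) \<in> Lg m"
      by (simp only: push_def)
  qed
  then show thesis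
    using that[of g] g seg by (auto simp: continuous_map_Lg_space)
qed

text \<open>The same approximation with the identity as morphism, to reach the maps with values in
  \<open>X\<close> to which \<open>homotopic_lift\<close> applies.\<close>

lemma approximate_in_A:
  fixes f :: "'k \<Rightarrow> nat \<Rightarrow> 'a"
  assumes "compact_space K" "continuous_map K (Lg_space m) f"
  obtains g where "continuous_map K (Lg_space m) g"
    "\<And>k. k \<in> topspace K \<Longrightarrow> g k \<in> PiE {..<m} (\<lambda>_. X)"
    "homotopic_with (\<lambda>_. True) K (Lg_space m) f g"
proof -
  have f: "continuous_map K (tuples m) f" "f ` topspace K \<subseteq> Lg m"
    using assms(2) by (auto simp: continuous_map_Lg_space)
  obtain g where g: "continuous_map K (tuples m) g"
    "\<And>k. k \<in> topspace K \<Longrightarrow> g k \<in> PiE {..<m} (\<lambda>_. X)"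
    "\<And>k t. k \<in> topspace K \<Longrightarrow> t \<in> {0..1} \<Longrightarrow> tsegment m t (f k) (\<lambda>j. g k j) \<in> Lg m"
    by (rule approximate_by_dense_subspace[where \<phi> = "\<lambda>x. x" and X = X,
          OF _ _ _ _ _ _ assms(1) f(1) openin_Lg[OF open_A] f(2)])
       (use dense_X X_closed zero_in_X in auto)
  have "homotopic_with (\<lambda>_. True) K (Lg_space m) f g"
    by (rule homotopic_with_Lg_segment[OF f(1) g(1)]) (use g(3) in simp)
  then show thesis
    using that[of g] g(2) homotopic_with_imp_continuous_maps by blast
qed

text \<open>Segments between tuples over \<open>X\<close> remain over \<open>X\<close>, so their
  unimodularity can be checked after applying \<open>\<phi>\<close>.\<close>

lemma homotopic_lift:
  assumes "continuous_map K (Lg_space m) f" "continuous_map K (Lg_space m) g"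
    and "\<And>k. k \<in> topspace K \<Longrightarrow> f k \<in> PiE {..<m} (\<lambda>_. X)"
    and "\<And>k. k \<in> topspace K \<Longrightarrow> g k \<in> PiE {..<m} (\<lambda>_. X)"
    and "\<And>k t. k \<in> topspace K \<Longrightarrow> t \<in> {0..1} \<Longrightarrow> tsegment m t (push m (f k)) (push m (g k)) \<in> Lg m"
  shows "homotopic_with (\<lambda>_. True) K (Lg_space m) f g"
proof (rule homotopic_with_Lg_segment)
  show "continuous_map K (tuples m) f" "continuous_map K (tuples m) g"
    using assms(1,2) by (auto simp: continuous_map_Lg_space)
  fix k and t :: real assume kt: "k \<in> topspace K" "t \<in> {0..1}"
  show "tsegment m t (f k) (g k) \<in> Lg m"
  proof (rule Lg_reflect)
    show "tsegment m t (f k) (g k) \<in> PiE {..<m} (\<lambda>_. X)"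
      using assms(3,4) kt by (intro tsegment_in_X) auto
    show "(\<lambda>j\<in>{..<m}. \<phi> (tsegment m t (f k) (g k) j)) \<in> Lg m"
      using assms(5)[OF kt] by (simp only: push_def[symmetric] push_tsegment)
  qed
qed

text \<open>A segment joins \<open>f\<close> to the image of a map \<open>g\<close> into tuples over
  \<open>'a\<close>, and the null-homotopy of \<open>g\<close> is pushed forward.\<close>

lemma nullhomotopic_A_imp_B:
  assumes null: "\<And>f. continuous_map K (Lg_space m :: (nat \<Rightarrow> 'a) topology) f \<Longrightarrow>
      \<exists>c. homotopic_with (\<lambda>_. True) K (Lg_space m) f (\<lambda>_. c)"
    and K: "compact_space K" and f: "continuous_map K (Lg_space m :: (nat \<Rightarrow> 'b) topology) f"
  shows "\<exists>c. homotopic_with (\<lambda>_. True) K (Lg_space m) f (\<lambda>_. c)"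
proof -
  obtain g where g: "continuous_map K (Lg_space m) g"
    "\<And>k t. k \<in> topspace K \<Longrightarrow> t \<in> {0..1} \<Longrightarrow> tsegment m t (f k) (push m (g k)) \<in> Lg m"
    using approximate_in_B[OF K f] by metis
  obtain c where c: "homotopic_with (\<lambda>_. True) K (Lg_space m) g (\<lambda>_. c)"
    using null[OF g(1)] by blast
  have "homotopic_with (\<lambda>_. True) K (Lg_space m) f (\<lambda>k. push m (g k))"
    by (rule homotopic_with_Lg_segment)
       (use f g continuous_map_compose[OF g(1) continuous_map_push] in
        \<open>auto simp: continuous_map_Lg_space o_def\<close>)
  moreover have "homotopic_with (\<lambda>_. True) K (Lg_space m) (push m \<circ> g) (push m \<circ> (\<lambda>_. c))"
    by (rule homotopic_with_compose_continuous_map_left[OF c continuous_map_push]) simp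
  ultimately have "homotopic_with (\<lambda>_. True) K (Lg_space m) f (\<lambda>_. push m c)"
    unfolding o_def by (rule homotopic_with_trans)
  then show ?thesis by blast
qed

text \<open>The approximation is made on the whole cylinder: \<open>G\<close> is a homotopy over
  \<open>'a\<close> near a null-homotopy \<open>H\<close> over \<open>'b\<close>, and segments join
  its end slices to \<open>g\<close> and to a constant.\<close>

lemma nullhomotopic_B_imp_A:
  assumes null: "\<And>f. continuous_map (nsphere n) (Lg_space m :: (nat \<Rightarrow> 'b) topology) f \<Longrightarrow>
      \<exists>c. homotopic_with (\<lambda>_. True) (nsphere n) (Lg_space m) f (\<lambda>_. c)"
    and f: "continuous_map (nsphere n) (Lg_space m :: (nat \<Rightarrow> 'a) topology) f"
  shows "\<exists>c. homotopic_with (\<lambda>_. True) (nsphere n) (Lg_space m) f (\<lambda>_. c)"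
proof -
  let ?S = "nsphere n"
  let ?K = "prod_topology (top_of_set {0..1::real}) ?S"
  obtain g where g: "continuous_map ?S (Lg_space m) g"
    "\<And>k. k \<in> topspace ?S \<Longrightarrow> g k \<in> PiE {..<m} (\<lambda>_. X)"
    "homotopic_with (\<lambda>_. True) ?S (Lg_space m) f g"
    using approximate_in_A[OF compact_space_nsphere f] by metis
  define b where "b = g sphere_base"
  have b: "b \<in> PiE {..<m} (\<lambda>_. X)" "b \<in> topspace (Lg_space m)"
    using g(2) continuous_map_image_subset_topspace[OF g(1)] sphere_base_in_nsphere[of n]
    by (auto simp: b_def simp del: PiE_iff)
  have "continuous_map ?S (Lg_space m) (push m \<circ> g)"
    by (rule continuous_map_compose[OF g(1) continuous_map_push])
  then obtain c where "homotopic_with (\<lambda>_. True) ?S (Lg_space m) (push m \<circ> g) (\<lambda>_. c)"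
    using null by blast
  \<comment> \<open>The constant \<open>c\<close> need not come from a tuple over \<open>X\<close>.
    The pointed version ends at \<open>push m b\<close> with \<open>b\<close> over \<open>X\<close>,
    so the final slice can be treated by \<open>homotopic_lift\<close> as well.\<close>
  from nullhomotopic_imp_pointed_nullhomotopic[OF this]
  obtain H where H: "continuous_map ?K (Lg_space m) H"
    "\<And>x. H (0, x) = push m (g x)" "\<And>x. H (1, x) = push m b"
    unfolding homotopic_with_def b_def o_def by blast
  have "compact_space ?K"
    by (simp add: compact_space_prod_topology compact_space_nsphere compact_space_subtopology)
  then obtain G where G: "continuous_map ?K (Lg_space m) G"
    "\<And>z. z \<in> topspace ?K \<Longrightarrow> G z \<in> PiE {..<m} (\<lambda>_. X)"
    "\<And>z t. z \<in> topspace ?K \<Longrightarrow> t \<in> {0..1} \<Longrightarrow> tsegment m t (H z) (push m (G z)) \<in> Lg m"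
    using approximate_in_B[OF _ H(1)] by metis
  have G01: "homotopic_with (\<lambda>_. True) ?S (Lg_space m) (\<lambda>k. G (0, k)) (\<lambda>k. G (1, k))"
    by (rule homotopic_with_time_slices[OF G(1)])
  note G_cont = homotopic_with_imp_continuous_maps[OF G01]
  have "homotopic_with (\<lambda>_. True) ?S (Lg_space m) g (\<lambda>k. G (0, k))"
  proof (rule homotopic_lift)
    \<comment> \<open>The slice of \<open>H\<close> at time 0 is \<open>push m (g k)\<close>, so the
      approximating segment already runs between images of tuples over \<open>X\<close>.\<close>
    show "tsegment m t (push m (g k)) (push m (G (0, k))) \<in> Lg m"
      if "k \<in> topspace ?S" "t \<in> {0..1}" for k t
      using G(3)[of "(0, k)" t] that by (simp add: H)
  qed (use g G(2) G_cont in auto)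
  moreover have "homotopic_with (\<lambda>_. True) ?S (Lg_space m) (\<lambda>_. b) (\<lambda>k. G (1, k))"
  proof (rule homotopic_lift)
    show "tsegment m t (push m b) (push m (G (1, k))) \<in> Lg m"
      if "k \<in> topspace ?S" "t \<in> {0..1}" for k t
      using G(3)[of "(1, k)" t] that by (simp add: H)
  qed (use b G(2) G_cont in auto)
  ultimately have "homotopic_with (\<lambda>_. True) ?S (Lg_space m) f (\<lambda>_. b)"
    using g(3) G01 by (meson homotopic_with_trans homotopic_with_symD)
  then show ?thesis by blast
qed

lemma k_connected_Lg_iff:
  assumes "m \<ge> 1"
  shows "k_connected_space k (Lg_space m :: (nat \<Rightarrow> 'a) topology) \<longleftrightarrow>
    k_connected_space k (Lg_space m :: (nat \<Rightarrow> 'b) topology)"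
proof -
  have "(\<forall>f. continuous_map (nsphere i) (Lg_space m :: (nat \<Rightarrow> 'a) topology) f \<longrightarrow>
        (\<exists>c. homotopic_with (\<lambda>_. True) (nsphere i) (Lg_space m) f (\<lambda>_. c))) \<longleftrightarrow>
      (\<forall>f. continuous_map (nsphere i) (Lg_space m :: (nat \<Rightarrow> 'b) topology) f \<longrightarrow>
        (\<exists>c. homotopic_with (\<lambda>_. True) (nsphere i) (Lg_space m) f (\<lambda>_. c)))" for i
    using nullhomotopic_A_imp_B[OF _ compact_space_nsphere, of i m] nullhomotopic_B_imp_A[of i m]
    by blast
  then show ?thesis
    unfolding k_connected_space_def trivial_homotopy_classes_iff
    using Lg_space_nonempty[OF assms, where 'a = 'a] Lg_space_nonempty[OF assms, where 'a = 'b]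
    by simp
qed

end

theorem proposition6p15:
  fixes \<phi> :: "'a::frechet_algebra \<Rightarrow> 'b::frechet_algebra"
  assumes "good_algebra TYPE('a)"
    and "good_algebra TYPE('b)"
    and "algebra_morphism \<phi>"
    and "dense_morphism \<phi>"
    and "relatively_spectral \<phi>"
  shows "\<forall>k::nat. csr k TYPE('a) = csr k TYPE('b)"
proof -
  obtain X where "unital_subalgebra X" "closure X = UNIV"
    "\<And>x. x \<in> X \<Longrightarrow> alg_spectrum (\<phi> x) = alg_spectrum x"
    using assms(5) by (auto simp: relatively_spectral_def)
  then interpret relatively_spectral_morphism \<phi> X
    using assms by unfold_locales (auto simp: good_algebra_def)
  \<comment> \<open>\<open>csr\<close> sees the algebra only through this set, and every
    \<open>m\<close> in it is at least 1, as \<open>k_connected_Lg_iff\<close> requires.\<close>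
  have "{n. n \<ge> 1 \<and> (\<forall>m\<ge>n. k_connected_space k (Lg_space m :: (nat \<Rightarrow> 'a) topology))} =
      {n. n \<ge> 1 \<and> (\<forall>m\<ge>n. k_connected_space k (Lg_space m :: (nat \<Rightarrow> 'b) topology))}" for k
    using k_connected_Lg_iff[of _ k] by (intro Collect_cong) (meson order_trans)
  then show ?thesis
    unfolding csr_def by simp
qed

end
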